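(* Let $n,k,c$ be integers with $c\ge 2$ and $1\le k\le n/2$, and let $\boldsymbol{\ell}=(\ell_1,\ldots,\ell_c)$ be a vector of integers with $\ell_r\ge 1$ for each $r$ and $\ell_1+\cdots+\ell_c=n$. Then the relative entropy $D(n,k,\boldsymbol{\ell})$ between the multivariate hypergeometric distribution $H(n,k,\boldsymbol{\ell};\cdot)$ and the multinomial distribution $B(n,k,\boldsymbol{\ell};\cdot)$ satisfies $$D(n,k,\boldsymbol{\ell})\le \frac{c-1}{2}\left(\log\left(\frac{n}{n-k}\right)-\frac{k}{n-1}\right)+\frac{k(2n+1)}{12n(n-1)(n-k)}\sum_{i=1}^c\frac{n}{\ell_i}+\frac{1}{360}\left(\frac{1}{(n-k)^3}-\frac{1}{n^3}\right)\sum_{i=1}^c\frac{n^3}{\ell_i^3}.$$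
   Context: For a vector $\boldsymbol{u}=(u_1,\ldots,u_c)$ of nonnegative integers with $u_1+\cdots+u_c=v$, write $\binom{v}{\boldsymbol{u}}=v!/\prod_{i=1}^c u_i!$. The multivariate hypergeometric p.m.f. (sampling $k$ balls without replacement from an urn of $n$ balls with $\ell_i$ balls of colour $i$) is $$H(n,k,\boldsymbol{\ell};\boldsymbol{s})=\frac{\prod_{i=1}^c\binom{\ell_i}{s_i}}{\binom{n}{k}}$$ for integer vectors $\boldsymbol{s}=(s_1,\ldots,s_c)$ with $0\le s_i\le \ell_i$ and $s_1+\cdots+s_c=k$ (and $0$ for other $\boldsymbol{s}$). The multinomial p.m.f. (sampling with replacement) is $$B(n,k,\boldsymbol{\ell};\boldsymbol{s})=\binom{k}{\boldsymbol{s}}\prod_{i=1}^c\left(\frac{\ell_i}{n}\right)^{s_i}$$ for integer vectors $\boldsymbol{s}$ with $s_i\ge 0$ and $s_1+\cdots+s_c=k$. The relative entropy is $$D(n,k,\boldsymbol{\ell})=\sum_{\boldsymbol{s}}H(n,k,\boldsymbol{\ell};\boldsymbol{s})\log\left(\frac{H(n,k,\boldsymbol{\ell};\boldsymbol{s})}{B(n,k,\boldsymbol{\ell};\boldsymbol{s})}\right),$$ with $\log$ the natural logarithm and $0\log 0=0$. *)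

theory Defs
  imports Complex_Main "HOL-Library.FuncSet"
begin

text \<open>
  Vectors with \<open>c\<close> entries are functions on the index set \<open>{1..c}\<close>. Sample vectors are taken
  to be extensional (\<open>undefined\<close> outside \<open>{1..c}\<close>), so that each integer vector is represented by
  exactly one function and sums over vectors count each vector once.
\<close>

definition count_vectors :: "nat \<Rightarrow> nat \<Rightarrow> (nat \<Rightarrow> nat) set" where
  "count_vectors c k = {s \<in> {1..c} \<rightarrow>\<^sub>E (UNIV :: nat set). (\<Sum>i=1..c. s i) = k}"

text \<open>Finiteness matters because \<^const>\<open>sum\<close> is 0 on infinite sets.\<close>

lemma finite_count_vectors: "finite (count_vectors c k)"
proof (rule finite_subset)
  show "count_vectors c k \<subseteq> {1..c} \<rightarrow>\<^sub>E {..k}"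
  proof
    fix s assume s: "s \<in> count_vectors c k"
    have "s i \<le> k" if "i \<in> {1..c}" for i
      using s that member_le_sum[of i "{1..c}" s] by (simp add: count_vectors_def)
    with s show "s \<in> {1..c} \<rightarrow>\<^sub>E {..k}"
      by (auto simp: count_vectors_def PiE_iff)
  qed
qed (auto intro: finite_PiE)

definition multinomial_coeff :: "nat \<Rightarrow> nat \<Rightarrow> (nat \<Rightarrow> nat) \<Rightarrow> real" where
  "multinomial_coeff c v u = fact v / (\<Prod>i=1..c. fact (u i))"

definition hypergeom_mass :: "nat \<Rightarrow> nat \<Rightarrow> nat \<Rightarrow> (nat \<Rightarrow> nat) \<Rightarrow> (nat \<Rightarrow> nat) \<Rightarrow> real" where
  "hypergeom_mass c n k l s =
     (if s \<in> count_vectors c k \<and> (\<forall>i\<in>{1..c}. s i \<le> l i)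
      then (\<Prod>i=1..c. real (l i choose s i)) / real (n choose k)
      else 0)"

definition multinomial_mass :: "nat \<Rightarrow> nat \<Rightarrow> nat \<Rightarrow> (nat \<Rightarrow> nat) \<Rightarrow> (nat \<Rightarrow> nat) \<Rightarrow> real" where
  "multinomial_mass c n k l s =
     (if s \<in> count_vectors c k
      then multinomial_coeff c k s * (\<Prod>i=1..c. (real (l i) / real n) ^ s i)
      else 0)"

text \<open>
  Both mass functions vanish outside \<^term>\<open>count_vectors c k\<close>. The convention \<open>0 log 0 = 0\<close>
  is built in: where the hypergeometric mass is 0, the summand is a product with factor 0.
\<close>

definition rel_entropy :: "nat \<Rightarrow> nat \<Rightarrow> nat \<Rightarrow> (nat \<Rightarrow> nat) \<Rightarrow> real" where
  "rel_entropy c n k l =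
     (\<Sum>s\<in>count_vectors c k.
        hypergeom_mass c n k l s * ln (hypergeom_mass c n k l s / multinomial_mass c n k l s))"

end

theory Submission
  imports Defs "HOL-Analysis.Gamma_Function" "HOL-Real_Asymp.Real_Asymp"
begin

text \<open>
  Up to terms that depend only on \<open>n\<close> and \<open>k\<close>, the relative entropy is a sum over the colours of
  \<open>ln l\<^sub>i! - E ln T\<^sub>i! - k l\<^sub>i/n ln l\<^sub>i\<close>, where \<open>T\<^sub>i = l\<^sub>i - S\<^sub>i\<close> is the number of balls of colour \<open>i\<close>
  left in the urn. Since the fourth derivative of \<open>ln \<Gamma>\<close> is positive, its cubic Taylor polynomial
  at the mean \<open>\<mu>\<^sub>i = l\<^sub>i (n - k)/n\<close> bounds \<open>ln T\<^sub>i!\<close> from below, also at \<open>T\<^sub>i = 0\<close>. The linear term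
  has mean 0, the quadratic one gives the variance, and the cubic ones add up to something
  nonnegative: at most one colour has \<open>l\<^sub>i/n > 1/2\<close>, and the others compensate for it because \<open>\<psi>''\<close>
  is monotone. What remains are differences \<open>ln \<Gamma>(l\<^sub>i) - ln \<Gamma>(\<mu>\<^sub>i)\<close>, bounded by the fact that the
  error of a truncated Stirling series is monotone.
\<close>

subsection \<open>Stirling bounds for the log-gamma function\<close>

text \<open>
  Telescoping against \<open>\<psi>(t + 1) - \<psi>(t) = 1/t\<close>: an asymptotic expansion \<open>g\<close> of \<open>\<psi>\<close> is a one-sided bound
  as soon as \<open>g(t + 1) - g(t)\<close> compares with \<open>1/t\<close>.
\<close>

lemma Digamma_LIMSEQ_of_asymp_ln:
  fixes x :: real and g :: "real \<Rightarrow> real"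
  assumes "x > 0" and lim: "((\<lambda>t. g t - ln t) \<longlongrightarrow> 0) at_top"
  shows "(\<lambda>m. g (x + real m) - (\<Sum>n<m. 1 / (x + real n))) \<longlonglongrightarrow> Digamma x"
proof -
  \<comment> \<open>The limit formula for \<open>Digamma\<close> contains
    \<open>ln (real m)\<close>. Trading it for \<open>g (x + real m)\<close> adds two null
    sequences, established next.\<close>
  have "(\<lambda>m. ln (real m) - (\<Sum>n<m. 1 / (x + real n))) \<longlonglongrightarrow> Digamma x"
    using Digamma_LIMSEQ[of x] \<open>x > 0\<close> by (simp add: inverse_eq_divide)
  moreover have "filterlim (\<lambda>m. x + real m) at_top sequentially"
    by real_asymp
  from filterlim_compose[OF lim this]
  have "(\<lambda>m. g (x + real m) - ln (x + real m)) \<longlonglongrightarrow> 0" .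
  moreover have "(\<lambda>m. ln (x + real m) - ln (real m)) \<longlonglongrightarrow> 0"
    by real_asymp
  ultimately have "(\<lambda>m. (ln (real m) - (\<Sum>n<m. 1 / (x + real n)))
      + (g (x + real m) - ln (x + real m)) + (ln (x + real m) - ln (real m)))
      \<longlonglongrightarrow> Digamma x + 0 + 0"
    by (intro tendsto_add)
  then show ?thesis
    by (simp add: algebra_simps)
qed

text \<open>The sequence of \<open>Digamma_LIMSEQ_of_asymp_ln\<close> equals \<open>g x\<close> at
  \<open>m = 0\<close> and never decreases by \<open>step\<close>, so its limit is at least
  \<open>g x\<close>.\<close>

lemma Digamma_ge_of_difference:
  fixes x :: real and g :: "real \<Rightarrow> real"
  assumes "x > 0" and lim: "((\<lambda>t. g t - ln t) \<longlongrightarrow> 0) at_top"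
    and step: "\<And>t. t > 0 \<Longrightarrow> 1 / t \<le> g (t + 1) - g t"
  shows "g x \<le> Digamma x"
proof (rule LIMSEQ_le_const[OF Digamma_LIMSEQ_of_asymp_ln[OF assms(1,2)]], intro exI allI impI)
  fix m :: nat
  show "g x \<le> g (x + real m) - (\<Sum>n<m. 1 / (x + real n))"
  proof (induction m)
    case (Suc m)
    then show ?case
      using step[of "x + real m"] \<open>x > 0\<close> by (simp add: add_ac)
  qed simp
qed

lemma Digamma_le_of_difference:
  fixes x :: real and g :: "real \<Rightarrow> real"
  assumes "x > 0" and lim: "((\<lambda>t. g t - ln t) \<longlongrightarrow> 0) at_top"
    and step: "\<And>t. t > 0 \<Longrightarrow> g (t + 1) - g t \<le> 1 / t"
  shows "Digamma x \<le> g x"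
proof (rule LIMSEQ_le_const2[OF Digamma_LIMSEQ_of_asymp_ln[OF assms(1,2)]], intro exI allI impI)
  fix m :: nat
  show "g (x + real m) - (\<Sum>n<m. 1 / (x + real n)) \<le> g x"
  proof (induction m)
    case (Suc m)
    then show ?case
      using step[of "x + real m"] \<open>x > 0\<close> by (simp add: add_ac)
  qed simp
qed

text \<open>The defect \<open>h\<close> in the step inequality tends to 0 at infinity and has
  negative derivative, so it is positive. Differentiation removes the logarithms and leaves a
  rational function of one sign.\<close>

lemma Digamma_ge:
  fixes x :: real
  assumes "x > 0"
  shows "ln x - 1 / (2 * x) - 1 / (12 * x ^ 2) \<le> Digamma x"
proof (rule Digamma_ge_of_difference[where g = "\<lambda>x. ln x - 1 / (2 * x) - 1 / (12 * x ^ 2)", OF assms])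
  show "((\<lambda>t::real. ln t - 1 / (2 * t) - 1 / (12 * t ^ 2) - ln t) \<longlongrightarrow> 0) at_top"
    by real_asymp
next
  fix t :: real
  assume "t > 0"
  define h where "h = (\<lambda>t::real. (ln (t + 1) - 1 / (2 * (t + 1)) - 1 / (12 * (t + 1) ^ 2))
    - (ln t - 1 / (2 * t) - 1 / (12 * t ^ 2)) - 1 / t)"
  have "0 < h t"
  proof (rule DERIV_neg_imp_decreasing_at_top[where f = h and b = t])
    show "(h \<longlongrightarrow> 0) at_top"
      unfolding h_def by real_asymp
    fix y assume "t \<le> y"
    with \<open>t > 0\<close> have y: "y > 0" by simp
    have "(h has_real_derivative - 1 / (6 * y ^ 3 * (y + 1) ^ 3)) (at y)"
      unfolding h_def
      using y
      by (auto intro!: derivative_eq_intros) (simp add: divide_simps, algebra)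
    moreover have "- 1 / (6 * y ^ 3 * (y + 1) ^ 3) < 0"
      using y by simp
    ultimately show "\<exists>d. (h has_real_derivative d) (at y) \<and> d < 0"
      by blast
  qed
  then show "1 / t \<le> (ln (t + 1) - 1 / (2 * (t + 1)) - 1 / (12 * (t + 1) ^ 2))
    - (ln t - 1 / (2 * t) - 1 / (12 * t ^ 2))"
    unfolding h_def by simp
qed

text \<open>The next term of the asymptotic series reverses the sign of the defect, so
  \<open>h\<close> is set up here with the opposite sign; the argument is that of
  \<open>Digamma_ge\<close>.\<close>

lemma Digamma_le:
  fixes x :: real
  assumes "x > 0"
  shows "Digamma x \<le> ln x - 1 / (2 * x) - 1 / (12 * x ^ 2) + 1 / (120 * x ^ 4)"
proof (rule Digamma_le_of_difference
    [where g = "\<lambda>x. ln x - 1 / (2 * x) - 1 / (12 * x ^ 2) + 1 / (120 * x ^ 4)", OF assms])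
  show "((\<lambda>t::real. ln t - 1 / (2 * t) - 1 / (12 * t ^ 2) + 1 / (120 * t ^ 4) - ln t) \<longlongrightarrow> 0) at_top"
    by real_asymp
next
  fix t :: real
  assume "t > 0"
  define h where "h = (\<lambda>t::real. 1 / t
    + (ln t - 1 / (2 * t) - 1 / (12 * t ^ 2) + 1 / (120 * t ^ 4))
    - (ln (t + 1) - 1 / (2 * (t + 1)) - 1 / (12 * (t + 1) ^ 2) + 1 / (120 * (t + 1) ^ 4)))"
  have "0 < h t"
  proof (rule DERIV_neg_imp_decreasing_at_top[where f = h and b = t])
    show "(h \<longlongrightarrow> 0) at_top"
      unfolding h_def by real_asymp
    fix y assume "t \<le> y"
    with \<open>t > 0\<close> have y: "y > 0" by simp
    have "(h has_real_derivative - (5 * y ^ 2 + 5 * y + 1) / (30 * y ^ 5 * (y + 1) ^ 5)) (at y)"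
      unfolding h_def
      using y
      by (auto intro!: derivative_eq_intros) (simp add: divide_simps, algebra)
    moreover have "- (5 * y ^ 2 + 5 * y + 1) / (30 * y ^ 5 * (y + 1) ^ 5) < 0"
      unfolding minus_divide_left[symmetric] neg_less_0_iff_less
      using y by (intro divide_pos_pos mult_pos_pos add_pos_pos) simp_all
    ultimately show "\<exists>d. (h has_real_derivative d) (at y) \<and> d < 0"
      by blast
  qed
  then show "(ln (t + 1) - 1 / (2 * (t + 1)) - 1 / (12 * (t + 1) ^ 2) + 1 / (120 * (t + 1) ^ 4))
    - (ln t - 1 / (2 * t) - 1 / (12 * t ^ 2) + 1 / (120 * t ^ 4)) \<le> 1 / t"
    unfolding h_def by simp
qed

text \<open>The derivative of the Stirling error is the gap in \<open>Digamma_ge\<close>. Only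
  differences of \<open>ln_Gamma\<close> are needed later, and the monotone form avoids the constant
  \<open>ln (2 * pi) / 2\<close>.\<close>

lemma ln_Gamma_Stirling_mono:
  fixes x y :: real
  assumes "0 < x" "x \<le> y"
  shows "ln_Gamma x - ((x - 1 / 2) * ln x - x + 1 / (12 * x))
    \<le> ln_Gamma y - ((y - 1 / 2) * ln y - y + 1 / (12 * y))"
proof (rule DERIV_nonneg_imp_nondecreasing[OF assms(2)])
  fix t assume "x \<le> t"
  with assms have t: "t > 0" by simp
  have "((\<lambda>t. ln_Gamma t - ((t - 1 / 2) * ln t - t + 1 / (12 * t))) has_real_derivative
      Digamma t - (ln t - 1 / (2 * t) - 1 / (12 * t ^ 2))) (at t)"
    using t by (auto intro!: derivative_eq_intros simp: field_simps power2_eq_square)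
  then show "\<exists>d. ((\<lambda>t. ln_Gamma t - ((t - 1 / 2) * ln t - t + 1 / (12 * t)))
      has_real_derivative d) (at t) \<and> 0 \<le> d"
    using Digamma_ge[OF t] by fastforce
qed

lemma ln_Gamma_Stirling_antimono:
  fixes x y :: real
  assumes "0 < x" "x \<le> y"
  shows "ln_Gamma y - ((y - 1 / 2) * ln y - y + 1 / (12 * y) - 1 / (360 * y ^ 3))
    \<le> ln_Gamma x - ((x - 1 / 2) * ln x - x + 1 / (12 * x) - 1 / (360 * x ^ 3))"
proof (rule DERIV_nonpos_imp_nonincreasing[OF assms(2)])
  fix t assume "x \<le> t"
  with assms have t: "t > 0" by simp
  have "((\<lambda>t. ln_Gamma t - ((t - 1 / 2) * ln t - t + 1 / (12 * t) - 1 / (360 * t ^ 3)))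
      has_real_derivative
      Digamma t - (ln t - 1 / (2 * t) - 1 / (12 * t ^ 2) + 1 / (120 * t ^ 4))) (at t)"
    using t by (auto intro!: derivative_eq_intros) (simp add: divide_simps, algebra)
  then show "\<exists>d. ((\<lambda>t. ln_Gamma t - ((t - 1 / 2) * ln t - t + 1 / (12 * t) - 1 / (360 * t ^ 3)))
      has_real_derivative d) (at t) \<and> d \<le> 0"
    using Digamma_le[OF t] by fastforce
qed

section \<open>Trigamma bound and cubic Taylor bound\<close>

text \<open>The series of \<open>1 / (x + real n) ^ 2\<close> for \<open>Polygamma 1 x\<close>
  dominates termwise the telescoping differences of \<open>a\<close>. Passing to
  \<open>x + 1\<close> subtracts \<open>1 / x ^ 2\<close>; this shift matches
  \<open>ln m! = ln_Gamma (m + 1)\<close>.\<close>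

lemma Polygamma_1_plus1_ge:
  fixes x :: real
  assumes "x > 0"
  shows "1 / x - 1 / (2 * x ^ 2) \<le> Polygamma 1 (x + 1)"
proof -
  define a where "a = (\<lambda>t::real. 1 / t + 1 / (2 * t ^ 2))"
  have tele: "(\<lambda>n. a (x + real n) - a (x + real (Suc n))) sums (a (x + real 0) - 0)"
    unfolding a_def by (intro telescope_sums') real_asymp
  have "(\<lambda>n. inverse ((x + real n) ^ Suc 1)) sums Polygamma 1 x"
    using Polygamma_LIMSEQ[of x 1] \<open>x > 0\<close> by simp
  then have ser: "(\<lambda>n. 1 / (x + real n) ^ 2) sums Polygamma 1 x"
    by (simp add: inverse_eq_divide power2_eq_square)
  have "a t - a (t + 1) \<le> 1 / t ^ 2" if "t > 0" for t
  proof -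
    have "1 / t ^ 2 - (a t - a (t + 1)) = 1 / (2 * t ^ 2 * (t + 1) ^ 2)"
      unfolding a_def using that by (simp add: divide_simps) algebra
    moreover have "1 / (2 * t ^ 2 * (t + 1) ^ 2) \<ge> 0" using that by simp
    ultimately show ?thesis by linarith
  qed
  from this[of "x + real _"]
  have "a (x + real n) - a (x + real (Suc n)) \<le> 1 / (x + real n) ^ 2" for n
    using \<open>x > 0\<close> by (simp add: add_ac add_pos_nonneg)
  then have "a (x + real 0) - 0 \<le> Polygamma 1 x"
    by (intro sums_le[OF _ tele ser])
  then have "a x \<le> Polygamma 1 x"
    by simp
  moreover have "Polygamma 1 (x + 1) = Polygamma 1 x - 1 / x ^ 2"
    using Polygamma_plus1[of x 1] \<open>x > 0\<close> by (simp add: power2_eq_square)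
  ultimately show ?thesis
    unfolding a_def by simp
qed

text \<open>The Lagrange remainder is a positive fourth derivative times the even power
  \<open>(y - x) ^ 4\<close>, hence nonnegative on both sides of \<open>x\<close>.\<close>

lemma ln_Gamma_cubic_lower_bound:
  fixes x y :: real
  assumes "0 < x" "0 < y"
  shows "ln_Gamma x + Digamma x * (y - x) + Polygamma 1 x / 2 * (y - x) ^ 2
    + Polygamma 2 x / 6 * (y - x) ^ 3 \<le> ln_Gamma y"
proof (cases "y = x")
  case False
  \<comment> \<open>\<open>d m\<close> is the derivative of order \<open>m\<close>.
    \<open>Polygamma j\<close> is the derivative of order \<open>j + 1\<close> of
    \<open>ln_Gamma\<close>, hence the shift.\<close>
  define d where "d = (\<lambda>m. if m = 0 then ln_Gamma else (Polygamma (m - 1) :: real \<Rightarrow> real))"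
  have der: "(d m has_real_derivative d (Suc m) t) (at t)" if "t > 0" for m t
  proof (cases m)
    case 0
    then show ?thesis using that by (auto simp: d_def intro!: derivative_eq_intros)
  next
    case (Suc j)
    have "t \<notin> \<int>\<^sub>\<le>\<^sub>0" using that by (auto elim!: nonpos_Ints_cases)
    then show ?thesis using Suc by (auto simp: d_def intro!: derivative_eq_intros)
  qed
  have "\<exists>t. (if y < x then y < t \<and> t < x else x < t \<and> t < y) \<and>
      ln_Gamma y = (\<Sum>m<4. d m x / fact m * (y - x) ^ m) + d 4 t / fact 4 * (y - x) ^ 4"
    by (rule Taylor[where a = "min x y" and b = "max x y"])
      (use False assms der in \<open>auto simp: d_def min_def split: if_splits\<close>)
  then obtain t where "(if y < x then y < t \<and> t < x else x < t \<and> t < y)"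
    and eq: "ln_Gamma y = (\<Sum>m<4. d m x / fact m * (y - x) ^ m) + d 4 t / fact 4 * (y - x) ^ 4"
    by blast
  then have "t > 0" using assms by (auto split: if_splits)
  then have "t \<notin> \<int>\<^sub>\<le>\<^sub>0" by (auto elim!: nonpos_Ints_cases)
  then have "0 \<le> d 4 t"
    using Polygamma_real_odd_pos[of t 3] by (simp add: d_def)
  then have "0 \<le> d 4 t / fact 4 * (y - x) ^ 4"
    by simp
  with eq show ?thesis
    by (simp add: d_def eval_nat_numeral)
qed simp

subsection \<open>Sums over count vectors\<close>

text \<open>Splitting off the last entry allows induction on \<open>c\<close>.\<close>

lemma sum_count_vectors_Suc:
  fixes f :: "(nat \<Rightarrow> nat) \<Rightarrow> 'a::comm_monoid_add"
  shows "(\<Sum>s\<in>count_vectors (Suc c) k. f s)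
    = (\<Sum>j\<le>k. \<Sum>s\<in>count_vectors c (k - j). f (s(Suc c := j)))"
proof -
  have "(\<Sum>s\<in>count_vectors (Suc c) k. f s)
    = (\<Sum>(j, s)\<in>(SIGMA j:{..k}. count_vectors c (k - j)). f (s(Suc c := j)))"
  \<comment> \<open>Removing the last entry means resetting it to \<open>undefined\<close>, since
    members of \<open>count_vectors c\<close> are extensional.\<close>
  proof (rule sum.reindex_bij_witness
      [where i = "\<lambda>(j, s). s(Suc c := j)" and j = "\<lambda>s. (s (Suc c), s(Suc c := undefined))"])
    fix s assume "s \<in> count_vectors (Suc c) k"
    then have "s \<in> insert (Suc c) {1..c} \<rightarrow>\<^sub>E UNIV" "(\<Sum>i=1..c. s i) + s (Suc c) = k"
      by (auto simp: count_vectors_def atLeastAtMostSuc_conv)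
    moreover from this have "s(Suc c := undefined) \<in> {1..c} \<rightarrow>\<^sub>E UNIV"
      by (intro fun_upd_in_PiE) auto
    ultimately show "(s (Suc c), s(Suc c := undefined)) \<in> (SIGMA j:{..k}. count_vectors c (k - j))"
      by (auto simp: count_vectors_def)
  next
    fix x assume "x \<in> (SIGMA j:{..k}. count_vectors c (k - j))"
    then obtain j s where x: "x = (j, s)" "j \<le> k" "s \<in> {1..c} \<rightarrow>\<^sub>E UNIV" "(\<Sum>i=1..c. s i) = k - j"
      by (auto simp: count_vectors_def)
    have "s (Suc c) = undefined"
      using x(3) by (rule PiE_arb) simp
    then show "(\<lambda>s. (s (Suc c), s(Suc c := undefined))) ((\<lambda>(j, s). s(Suc c := j)) x) = x"
      using x by auto
    have "s(Suc c := j) \<in> {1..Suc c} \<rightarrow>\<^sub>E UNIV"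
      using x(3) by (auto simp: PiE_iff extensional_def)
    then show "(\<lambda>(j, s). s(Suc c := j)) x \<in> count_vectors (Suc c) k"
      using x by (auto simp: count_vectors_def)
  qed auto
  then show ?thesis
    by (simp add: sum.Sigma finite_count_vectors)
qed

text \<open>Fixing the total of \<open>s\<close> amounts to extracting one coefficient from a
  product of generating functions, one per colour. Moments thus become coefficients of products of
  binomial series.\<close>

lemma sum_count_vectors_prod:
  fixes f :: "nat \<Rightarrow> nat \<Rightarrow> 'a::comm_ring_1"
  shows "(\<Sum>s\<in>count_vectors c k. \<Prod>i=1..c. f i (s i))
    = fps_nth (\<Prod>i=1..c. Abs_fps (f i)) k"
proof (induction c arbitrary: k)
  case 0
  have "count_vectors 0 k = (if k = 0 then {\<lambda>_. undefined} else {})"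
    by (auto simp: count_vectors_def)
  then show ?case by simp
next
  case (Suc c)
  have "(\<Sum>s\<in>count_vectors (Suc c) k. \<Prod>i=1..Suc c. f i (s i))
    = (\<Sum>j\<le>k. \<Sum>s\<in>count_vectors c (k - j). (\<Prod>i=1..c. f i (s i)) * f (Suc c) j)"
    by (simp add: sum_count_vectors_Suc)
  also have "\<dots> = (\<Sum>j\<le>k. f (Suc c) j * fps_nth (\<Prod>i=1..c. Abs_fps (f i)) (k - j))"
    by (simp del: One_nat_def add: mult.commute flip: sum_distrib_left Suc.IH)
  also have "\<dots> = fps_nth (Abs_fps (f (Suc c)) * (\<Prod>i=1..c. Abs_fps (f i))) k"
    by (simp add: fps_mult_nth atLeast0AtMost)
  finally show ?case
    by (simp add: mult.commute)
qed

lemma prod_fps_binomial_of_nat: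
  fixes l :: "'i \<Rightarrow> nat"
  assumes "finite I"
  shows "(\<Prod>i\<in>I. fps_binomial (of_nat (l i) :: 'a::field_char_0)) = fps_binomial (of_nat (\<Sum>i\<in>I. l i))"
  using assms by (induction I rule: finite_induct) (auto simp: fps_binomial_add_mult)

text \<open>Trinomial revision, \<open>C(l,s) C(s,r) = C(l,r) C(l-r,s-r)\<close>, followed by an
  index shift by \<open>r\<close>. The series \<open>fps_binomial a\<close> is
  \<open>(1 + X)^a\<close>.\<close>

lemma Abs_fps_choose_mult_choose:
  fixes l r :: nat
  assumes "r \<le> l"
  shows "Abs_fps (\<lambda>s. of_nat (l choose s) * of_nat (s choose r))
    = fps_const (of_nat (l choose r)) * (fps_X ^ r * fps_binomial (of_nat (l - r) :: 'a::field_char_0))"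
proof (rule fps_ext)
  fix s
  show "fps_nth (Abs_fps (\<lambda>s. of_nat (l choose s) * of_nat (s choose r) :: 'a)) s
    = fps_nth (fps_const (of_nat (l choose r)) * (fps_X ^ r * fps_binomial (of_nat (l - r)))) s"
  proof (cases "s < r")
    case False
    have "(l choose s) * (s choose r) = (l choose r) * (l - r choose (s - r))"
    proof (cases "s \<le> l")
      case True
      with False show ?thesis using choose_mult[of r s l] by simp
    next
      case beyond: False
      with assms have "l - r < s - r" by linarith
      with beyond show ?thesis by (simp add: binomial_eq_0)
    qed
    then have "of_nat (l choose s) * of_nat (s choose r)
      = (of_nat (l choose r) * of_nat (l - r choose (s - r)) :: 'a)"
      by (metis of_nat_mult)
    with False show ?thesis
      by (simp add: fps_X_power_mult_nth binomial_gbinomial)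
  qed (simp add: fps_X_power_mult_nth)
qed

text \<open>Colour \<open>i\<close> contributes \<open>C(l i,r) X^r (1 + X)^(l i - r)\<close>, the
  other colours complete the power to \<open>(1 + X)^(n - r)\<close>, and the coefficient of
  \<open>X^k\<close> is read off. The division-free form also covers \<open>r > n\<close>.\<close>

lemma sum_prod_choose_mult_choose:
  fixes l :: "nat \<Rightarrow> nat"
  assumes i: "i \<in> {1..c}" and n: "(\<Sum>j=1..c. l j) = n" and k: "k \<le> n"
  shows "(\<Sum>s\<in>count_vectors c k. (\<Prod>j=1..c. real (l j choose s j)) * real (s i choose r)) * real (n choose r)
    = real (l i choose r) * real (k choose r) * real (n choose k)"
proof (cases "r \<le> l i \<and> r \<le> k")
  case True
  define f where "f = (\<lambda>j s. if j = i then real (l j choose s) * real (s choose r) else real (l j choose s))"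
  define m where "m = (\<Sum>j\<in>{1..c} - {i}. l j)"
  have nm: "n = l i + m"
    using i n by (simp add: m_def sum.remove)
  have "(\<Sum>s\<in>count_vectors c k. (\<Prod>j=1..c. real (l j choose s j)) * real (s i choose r))
    = (\<Sum>s\<in>count_vectors c k. \<Prod>j=1..c. f j (s j))"
    using i by (intro sum.cong refl) (simp add: f_def prod.remove[where x = i])
  also have "\<dots> = fps_nth (\<Prod>j=1..c. Abs_fps (f j)) k"
    by (rule sum_count_vectors_prod)
  also have "(\<Prod>j=1..c. Abs_fps (f j)) = Abs_fps (f i) * (\<Prod>j\<in>{1..c} - {i}. Abs_fps (f j))"
    using i by (intro prod.remove) auto
  also have "(\<Prod>j\<in>{1..c} - {i}. Abs_fps (f j)) = (\<Prod>j\<in>{1..c} - {i}. fps_binomial (real (l j)))"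
    by (intro prod.cong refl fps_ext) (simp add: f_def binomial_gbinomial)
  also have "\<dots> = fps_binomial (real m)"
    unfolding m_def by (intro prod_fps_binomial_of_nat) simp
  also have "Abs_fps (f i) = fps_const (real (l i choose r)) * (fps_X ^ r * fps_binomial (real (l i - r)))"
    using Abs_fps_choose_mult_choose[of r "l i", where 'a = real] True by (simp add: f_def)
  also have "\<dots> * fps_binomial (real m)
    = fps_const (real (l i choose r)) * (fps_X ^ r * fps_binomial (real (l i - r) + real m))"
    by (simp only: mult.assoc fps_binomial_add_mult)
  also have "real (l i - r) + real m = real (n - r)"
    using True by (simp add: nm)
  finally have "(\<Sum>s\<in>count_vectors c k. (\<Prod>j=1..c. real (l j choose s j)) * real (s i choose r))
    = real (l i choose r) * real (n - r choose (k - r))"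
    using True by (simp add: fps_X_power_mult_nth binomial_gbinomial)
  moreover have "real (n choose k) * real (k choose r) = real (n choose r) * real (n - r choose (k - r))"
    using choose_mult[of r k n] True k by (metis of_nat_mult)
  ultimately show ?thesis
    by (simp add: mult_ac)
next
  case False
  \<comment> \<open>Either \<open>s i > l i\<close> and a binomial of the product vanishes, or
    \<open>s i\<close> is at most both \<open>l i\<close> and \<open>k\<close>, hence below
    \<open>r\<close>.\<close>
  have "(\<Prod>j=1..c. real (l j choose s j)) * real (s i choose r) = 0" if s: "s \<in> count_vectors c k" for s
  proof (cases "s i \<le> l i")
    case True
    have "s i \<le> k"
      using s i member_le_sum[of i "{1..c}" s] by (simp add: count_vectors_def)
    with True False have "s i < r" by linarith
    then show ?thesis by simp
  next
    case False
    then show ?thesis using i by (auto intro!: bexI[of _ i])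
  qed
  then have "(\<Sum>s\<in>count_vectors c k. (\<Prod>j=1..c. real (l j choose s j)) * real (s i choose r)) = 0"
    by (intro sum.neutral) blast
  then show ?thesis
    using False by auto
qed

subsection \<open>Hypergeometric moments\<close>

lemma hypergeom_mass_binomial_moment:
  assumes "i \<in> {1..c}" "(\<Sum>j=1..c. l j) = n" "k \<le> n"
  shows "(\<Sum>s\<in>count_vectors c k. hypergeom_mass c n k l s * real (s i choose r)) * real (n choose r)
    = real (l i choose r) * real (k choose r)"
proof -
  have mass: "hypergeom_mass c n k l s = (\<Prod>j=1..c. real (l j choose s j)) / real (n choose k)"
    if "s \<in> count_vectors c k" for s
  proof (cases "\<forall>j\<in>{1..c}. s j \<le> l j")
    case False
    then obtain j where "j \<in> {1..c}" "l j < s j" by force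
    then have "(\<Prod>j=1..c. real (l j choose s j)) = 0"
      by (intro prod_zero) auto
    with False show ?thesis by (simp add: hypergeom_mass_def)
  qed (use that in \<open>simp add: hypergeom_mass_def\<close>)
  have "real (n choose k) > 0" using assms(3) by simp
  moreover have "(\<Sum>s\<in>count_vectors c k. hypergeom_mass c n k l s * real (s i choose r))
    = (\<Sum>s\<in>count_vectors c k. (\<Prod>j=1..c. real (l j choose s j)) * real (s i choose r)) / real (n choose k)"
    by (simp add: mass sum_divide_distrib)
  ultimately show ?thesis
    using sum_prod_choose_mult_choose[OF assms, of r] by (simp only: times_divide_eq_left) simp
qed

lemma real_choose_two: "real (m choose 2) = real m * (real m - 1) / 2"
  by (simp add: binomial_gbinomial gbinomial_prod_rev eval_nat_numeral)

lemma real_choose_three: "real (m choose 3) = real m * (real m - 1) * (real m - 2) / 6"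
  by (simp add: binomial_gbinomial gbinomial_prod_rev eval_nat_numeral)

context
  fixes n k c i :: nat and l :: "nat \<Rightarrow> nat"
  assumes i: "i \<in> {1..c}" and sum_l: "(\<Sum>j=1..c. l j) = n" and k_le_n: "k \<le> n" and n_ge_2: "2 \<le> n"
begin

lemma sum_hypergeom_mass: "(\<Sum>s\<in>count_vectors c k. hypergeom_mass c n k l s) = 1"
  using hypergeom_mass_binomial_moment[OF i sum_l k_le_n, of 0] by simp

lemma hypergeom_mass_mean:
  "(\<Sum>s\<in>count_vectors c k. hypergeom_mass c n k l s * real (s i)) = real k * real (l i) / real n"
  using hypergeom_mass_binomial_moment[OF i sum_l k_le_n, of 1] n_ge_2
  by (simp add: field_simps)

lemma hypergeom_mass_factorial_moment_2:
  "(\<Sum>s\<in>count_vectors c k. hypergeom_mass c n k l s * (real (s i) * (real (s i) - 1)))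
    = real k * (real k - 1) * real (l i) * (real (l i) - 1) / (real n * (real n - 1))"
  using hypergeom_mass_binomial_moment[OF i sum_l k_le_n, of 2] n_ge_2
  by (simp add: real_choose_two field_simps flip: sum_divide_distrib)

text \<open>For \<open>n = 2\<close> the right-hand side is 0 because the denominator vanishes.\<close>

lemma hypergeom_mass_factorial_moment_3:
  "(\<Sum>s\<in>count_vectors c k. hypergeom_mass c n k l s * (real (s i) * (real (s i) - 1) * (real (s i) - 2)))
    = real k * (real k - 1) * (real k - 2) * real (l i) * (real (l i) - 1) * (real (l i) - 2)
      / (real n * (real n - 1) * (real n - 2))"
proof (cases "n = 2")
  case True
  have "hypergeom_mass c n k l s * (real (s i) * (real (s i) - 1) * (real (s i) - 2)) = 0"
    if "s \<in> count_vectors c k" for s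
  proof -
    have "s i \<le> 2"
      using that i k_le_n True member_le_sum[of i "{1..c}" s] by (simp add: count_vectors_def)
    then have "s i \<in> {0, 1, 2}" by auto
    then show ?thesis by auto
  qed
  then have "(\<Sum>s\<in>count_vectors c k.
      hypergeom_mass c n k l s * (real (s i) * (real (s i) - 1) * (real (s i) - 2))) = 0"
    by (intro sum.neutral) blast
  with True show ?thesis by simp
next
  case False
  with n_ge_2 have "real n * (real n - 1) * (real n - 2) \<noteq> 0"
    by auto
  moreover define S where "S = (\<Sum>s\<in>count_vectors c k.
      hypergeom_mass c n k l s * (real (s i) * (real (s i) - 1) * (real (s i) - 2)))"
  have "S * (real n * (real n - 1) * (real n - 2))
    = real k * (real k - 1) * (real k - 2) * real (l i) * (real (l i) - 1) * (real (l i) - 2)"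
    using hypergeom_mass_binomial_moment[OF i sum_l k_le_n, of 3]
    unfolding real_choose_three times_divide_eq_right sum_divide_distrib[symmetric] S_def[symmetric]
    by (simp add: algebra_simps add_divide_distrib diff_divide_distrib)
  ultimately show ?thesis
    unfolding S_def[symmetric] by (simp only: nonzero_eq_divide_eq not_False_eq_True)
qed

lemma hypergeom_mass_variance:
  defines "p \<equiv> real (l i) / real n"
  shows "(\<Sum>s\<in>count_vectors c k. hypergeom_mass c n k l s * (real (s i) - real k * p) ^ 2)
    = real k * p * (1 - p) * (real n - real k) / (real n - 1)"
proof -
  let ?H = "hypergeom_mass c n k l"
  have "(\<Sum>s\<in>count_vectors c k. ?H s * (real (s i) - real k * p) ^ 2)
    = (\<Sum>s\<in>count_vectors c k. ?H s * (real (s i) * (real (s i) - 1))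
        + (1 - 2 * (real k * p)) * (?H s * real (s i)) + (real k * p) ^ 2 * ?H s)"
    by (intro sum.cong refl) algebra
  also have "\<dots> = real k * (real k - 1) * real (l i) * (real (l i) - 1) / (real n * (real n - 1))
        + (1 - 2 * (real k * p)) * (real k * real (l i) / real n) + (real k * p) ^ 2"
    by (simp add: sum.distrib hypergeom_mass_mean hypergeom_mass_factorial_moment_2
        sum_hypergeom_mass flip: sum_distrib_left)
  also have "\<dots> = real k * p * (1 - p) * (real n - real k) / (real n - 1)"
    using n_ge_2 by (simp add: p_def divide_simps) algebra
  finally show ?thesis .
qed

lemma hypergeom_mass_third_central_moment:
  assumes "2 * k \<le> n"
  defines "p \<equiv> real (l i) / real n"
  shows "(\<Sum>s\<in>count_vectors c k. hypergeom_mass c n k l s * (real (s i) - real k * p) ^ 3)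
    = p * (1 - p) * (1 - 2 * p)
      * (real k * (real n - real k) * (real n - 2 * real k) / ((real n - 1) * (real n - 2)))"
proof -
  let ?H = "hypergeom_mass c n k l"
  \<comment> \<open>Rewriting \<open>x^3 = x(x-1)(x-2) + 3x(x-1) + x\<close> reduces the central
    moment to factorial moments.\<close>
  have "(\<Sum>s\<in>count_vectors c k. ?H s * (real (s i) - real k * p) ^ 3)
    = (\<Sum>s\<in>count_vectors c k. ?H s * (real (s i) * (real (s i) - 1) * (real (s i) - 2))
        + 3 * (1 - real k * p) * (?H s * (real (s i) * (real (s i) - 1)))
        + (1 - 3 * (real k * p) + 3 * (real k * p) ^ 2) * (?H s * real (s i)) - (real k * p) ^ 3 * ?H s)"
    by (intro sum.cong refl) algebra
  also have "\<dots> = real k * (real k - 1) * (real k - 2) * real (l i) * (real (l i) - 1) * (real (l i) - 2)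
      / (real n * (real n - 1) * (real n - 2))
      + 3 * (1 - real k * p) * (real k * (real k - 1) * real (l i) * (real (l i) - 1) / (real n * (real n - 1)))
        + (1 - 3 * (real k * p) + 3 * (real k * p) ^ 2) * (real k * real (l i) / real n) - (real k * p) ^ 3"
    by (simp add: sum.distrib sum_subtractf hypergeom_mass_mean hypergeom_mass_factorial_moment_2
        hypergeom_mass_factorial_moment_3 sum_hypergeom_mass flip: sum_distrib_left)
  also have "\<dots> = p * (1 - p) * (1 - 2 * p)
      * (real k * (real n - real k) * (real n - 2 * real k) / ((real n - 1) * (real n - 2)))"
  \<comment> \<open>For \<open>n = 2\<close> the quotients by \<open>n - 2\<close> are 0 by the
    convention for division. What remains is checked on the six possible pairs of \<open>l i\<close>
    and \<open>k\<close>.\<close>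
  proof (cases "n = 2")
    case True
    have "l i \<le> 2"
      using i sum_l True member_le_sum[of i "{1..c}" l] by simp
    then have "l i \<in> {0, 1, 2}" by auto
    moreover have "k \<in> {0, 1}" using True assms(1) by auto
    ultimately show ?thesis using True by (auto simp: p_def power2_eq_square power3_eq_cube)
  next
    case False
    then have n: "real n \<noteq> 0" "real n - 1 \<noteq> 0" "real n - 2 \<noteq> 0"
      using n_ge_2 by auto
    have l: "real (l i) = real n * p"
      using n by (simp add: p_def)
    show ?thesis
      unfolding l using n
      by (simp add: divide_simps) (simp add: algebra_simps power2_eq_square power3_eq_cube)
  qed
  finally show ?thesis .
qed

text \<open>Here \<mu> is the mean of the number of balls left, and the expansion point is
  \<open>\<mu> + 1\<close> because \<open>ln T! = ln_Gamma (T + 1)\<close>. The deviation of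
  \<open>T = l i - S\<close> is minus that of \<open>S\<close>, which gives the cubic term its minus
  sign.\<close>

lemma expectation_ln_fact_ge:
  assumes "2 * k \<le> n"
  defines "p \<equiv> real (l i) / real n"
  defines "\<mu> \<equiv> real (l i) * (real n - real k) / real n"
  shows "ln_Gamma (\<mu> + 1)
      + Polygamma 1 (\<mu> + 1) / 2 * (real k * p * (1 - p) * (real n - real k) / (real n - 1))
      - Polygamma 2 (\<mu> + 1) / 6 * (p * (1 - p) * (1 - 2 * p)
        * (real k * (real n - real k) * (real n - 2 * real k) / ((real n - 1) * (real n - 2))))
    \<le> (\<Sum>s\<in>count_vectors c k. hypergeom_mass c n k l s * ln (fact (l i - s i)))"
proof -
  let ?H = "hypergeom_mass c n k l"
  have \<mu>: "\<mu> = real (l i) - real k * p"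
    using n_ge_2 by (simp add: \<mu>_def p_def field_simps)
  have "\<mu> \<ge> 0"
    using k_le_n by (simp add: \<mu>_def)
  have "?H s * (ln_Gamma (\<mu> + 1)
      - Digamma (\<mu> + 1) * (real (s i) - real k * p)
      + Polygamma 1 (\<mu> + 1) / 2 * (real (s i) - real k * p) ^ 2
      - Polygamma 2 (\<mu> + 1) / 6 * (real (s i) - real k * p) ^ 3)
    \<le> ?H s * ln (fact (l i - s i))" for s
  \<comment> \<open>Where the mass is 0, \<open>s i\<close> may exceed \<open>l i\<close> and the
    natural subtraction be truncated, but both sides are then 0.\<close>
  proof (cases "?H s = 0")
    case False
    then have "s i \<le> l i" "0 \<le> ?H s"
      using i by (auto simp: hypergeom_mass_def split: if_splits intro!: divide_nonneg_nonneg prod_nonneg)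
    define y where "y = real (l i - s i) + 1"
    have y: "ln_Gamma y = ln (fact (l i - s i))"
      using ln_Gamma_real_conv_fact[of "Suc (l i - s i)"] by (simp add: y_def add.commute)
    have diff: "y - (\<mu> + 1) = - (real (s i) - real k * p)"
      using \<open>s i \<le> l i\<close> by (simp add: y_def \<mu>)
    have "0 < \<mu> + 1" "0 < y"
      using \<open>\<mu> \<ge> 0\<close> by (simp_all add: y_def)
    from ln_Gamma_cubic_lower_bound[OF this] \<open>0 \<le> ?H s\<close> show ?thesis
      unfolding diff y by (intro mult_left_mono) (simp_all add: power3_eq_cube power2_eq_square algebra_simps)
  qed simp
  then have "(\<Sum>s\<in>count_vectors c k. ?H s * (ln_Gamma (\<mu> + 1)
      - Digamma (\<mu> + 1) * (real (s i) - real k * p)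
      + Polygamma 1 (\<mu> + 1) / 2 * (real (s i) - real k * p) ^ 2
      - Polygamma 2 (\<mu> + 1) / 6 * (real (s i) - real k * p) ^ 3))
    \<le> (\<Sum>s\<in>count_vectors c k. ?H s * ln (fact (l i - s i)))"
    by (intro sum_mono)
  also have "(\<Sum>s\<in>count_vectors c k. ?H s * (ln_Gamma (\<mu> + 1)
      - Digamma (\<mu> + 1) * (real (s i) - real k * p)
      + Polygamma 1 (\<mu> + 1) / 2 * (real (s i) - real k * p) ^ 2
      - Polygamma 2 (\<mu> + 1) / 6 * (real (s i) - real k * p) ^ 3))
    = (ln_Gamma (\<mu> + 1) + Digamma (\<mu> + 1) * (real k * p)) * (\<Sum>s\<in>count_vectors c k. ?H s)
      - Digamma (\<mu> + 1) * (\<Sum>s\<in>count_vectors c k. ?H s * real (s i))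
      + Polygamma 1 (\<mu> + 1) / 2 * (\<Sum>s\<in>count_vectors c k. ?H s * (real (s i) - real k * p) ^ 2)
      - Polygamma 2 (\<mu> + 1) / 6 * (\<Sum>s\<in>count_vectors c k. ?H s * (real (s i) - real k * p) ^ 3)"
    unfolding sum_distrib_left sum.distrib[symmetric] sum_subtractf[symmetric]
    by (intro sum.cong refl) algebra
  also have "(\<Sum>s\<in>count_vectors c k. ?H s * real (s i)) = real k * p"
    by (simp add: hypergeom_mass_mean p_def)
  finally show ?thesis
    unfolding sum_hypergeom_mass hypergeom_mass_variance[folded p_def]
      hypergeom_mass_third_central_moment[OF assms(1), folded p_def]
    by simp
qed

end

section \<open>Sign of the weighted third moments\<close>

text \<open>Only an index \<open>j\<close> with \<open>p j > 1/2\<close> gives a negative term.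
  Every other \<open>i\<close> has \<open>p i \<le> 1 - p j\<close>, so
  \<open>(1 - p i) (1 - 2 p i) \<ge> p j (2 p j - 1)\<close> and \<open>q i \<ge> q j\<close>.
  Weighting by \<open>p i\<close>, with total \<open>1 - p j\<close>, yields exactly the size of the
  negative term.\<close>

lemma sum_skewness_nonneg:
  fixes p q :: "'i \<Rightarrow> real"
  assumes fin: "finite I" and p: "\<And>i. i \<in> I \<Longrightarrow> 0 \<le> p i" and total: "(\<Sum>i\<in>I. p i) = 1"
    and q: "\<And>i. i \<in> I \<Longrightarrow> 0 \<le> q i"
    and anti: "\<And>i j. i \<in> I \<Longrightarrow> j \<in> I \<Longrightarrow> p i \<le> p j \<Longrightarrow> q j \<le> q i"
  shows "0 \<le> (\<Sum>i\<in>I. q i * (p i * (1 - p i) * (1 - 2 * p i)))"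
proof (cases "\<exists>j\<in>I. 1 / 2 < p j")
  case False
  have "0 \<le> q i * (p i * (1 - p i) * (1 - 2 * p i))" if "i \<in> I" for i
  proof -
    have "p i \<le> 1 / 2" using False that by force
    then show ?thesis using p[OF that] q[OF that] by simp
  qed
  then show ?thesis by (rule sum_nonneg)
next
  case True
  then obtain j where j: "j \<in> I" "1 / 2 < p j" by blast
  have rest: "(\<Sum>i\<in>I - {j}. p i) = 1 - p j"
    using total by (simp add: sum.remove[OF fin j(1)])
  have "q j * p j * (2 * p j - 1) * p i \<le> q i * (p i * (1 - p i) * (1 - 2 * p i))" if i: "i \<in> I - {j}" for i
  proof -
    have "p i \<le> 1 - p j"
      using member_le_sum[of i "I - {j}" p] i fin p by (auto simp flip: rest)
    then have "p j * (2 * p j - 1) \<le> (1 - p i) * (1 - 2 * p i)"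
      using j by (intro mult_mono) auto
    moreover have "q j \<le> q i"
      using anti[of i j] i j \<open>p i \<le> 1 - p j\<close> by simp
    ultimately have "q j * (p j * (2 * p j - 1)) \<le> q i * ((1 - p i) * (1 - 2 * p i))"
      using q i j \<open>p i \<le> 1 - p j\<close> by (intro mult_mono mult_nonneg_nonneg) auto
    then have "p i * (q j * (p j * (2 * p j - 1))) \<le> p i * (q i * ((1 - p i) * (1 - 2 * p i)))"
      using p i by (intro mult_left_mono) auto
    then show ?thesis by (simp only: mult_ac)
  qed
  then have "(\<Sum>i\<in>I - {j}. q j * p j * (2 * p j - 1) * p i)
      \<le> (\<Sum>i\<in>I - {j}. q i * (p i * (1 - p i) * (1 - 2 * p i)))"
    by (rule sum_mono)
  then have "q j * p j * (2 * p j - 1) * (1 - p j)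
      \<le> (\<Sum>i\<in>I - {j}. q i * (p i * (1 - p i) * (1 - 2 * p i)))"
    by (simp add: rest flip: sum_distrib_left)
  then show ?thesis
    unfolding sum.remove[OF fin j(1)] by (simp add: algebra_simps)
qed

section \<open>Relative entropy as a sum over colours\<close>

text \<open>The factorials of \<open>s i\<close> and of \<open>k\<close> occur in both masses and
  cancel. Apart from \<open>ln (fact (l i - s i))\<close>, the logarithm is then affine in
  \<open>s\<close>.\<close>

lemma ln_hypergeom_multinomial_ratio:
  assumes "hypergeom_mass c n k l s \<noteq> 0" and pos: "\<And>i. i \<in> {1..c} \<Longrightarrow> 1 \<le> l i" and "k \<le> n" "0 < n"
  shows "ln (hypergeom_mass c n k l s / multinomial_mass c n k l s)
    = (\<Sum>i=1..c. ln (fact (l i)) - ln (fact (l i - s i)) - real (s i) * ln (real (l i)))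
      - ln (fact n) + ln (fact (n - k)) + real k * ln (real n)"
proof -
  from assms(1) have s: "s \<in> count_vectors c k" "\<And>i. i \<in> {1..c} \<Longrightarrow> s i \<le> l i"
    by (auto simp: hypergeom_mass_def split: if_splits)
  have sum_s: "(\<Sum>i=1..c. real (s i)) = real k"
    using s(1) by (auto simp: count_vectors_def simp flip: of_nat_sum)
  have ln_choose: "ln (real (a choose b)) = ln (fact a) - ln (fact b) - ln (fact (a - b))"
    if "b \<le> a" for a b
    using that by (simp add: binomial_fact ln_div ln_mult)
  have choose_pos: "0 < real (l i choose s i)" if "i \<in> {1..c}" for i
    using s(2)[OF that] by simp
  have Hpos: "0 < (\<Prod>i=1..c. real (l i choose s i))"
    by (intro prod_pos choose_pos)
  have H: "hypergeom_mass c n k l s = (\<Prod>i=1..c. real (l i choose s i)) / real (n choose k)"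
    using s by (auto simp: hypergeom_mass_def)
  have lnH: "ln (hypergeom_mass c n k l s)
    = (\<Sum>i=1..c. ln (fact (l i)) - ln (fact (s i)) - ln (fact (l i - s i)))
      - (ln (fact n) - ln (fact k) - ln (fact (n - k)))"
  proof -
    have "ln (\<Prod>i=1..c. real (l i choose s i)) = (\<Sum>i=1..c. ln (real (l i choose s i)))"
      by (intro ln_prod finite_atLeastAtMost less_imp_neq[OF choose_pos, THEN not_sym])
    also have "\<dots> = (\<Sum>i=1..c. ln (fact (l i)) - ln (fact (s i)) - ln (fact (l i - s i)))"
      using s(2) by (intro sum.cong refl ln_choose) auto
    finally show ?thesis
      unfolding H ln_choose[OF \<open>k \<le> n\<close>, symmetric]
      using ln_divide_pos[OF Hpos, of "real (n choose k)"] \<open>k \<le> n\<close> by simp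
  qed
  have Bpos1: "0 < (\<Prod>i=1..c. fact (s i) :: real)"
    by (intro prod_pos) simp
  have Bpos2: "0 < (\<Prod>i=1..c. (real (l i) / real n) ^ s i)"
    using pos \<open>0 < n\<close> by (intro prod_pos) (auto simp: Suc_le_eq)
  have B: "multinomial_mass c n k l s
    = fact k / (\<Prod>i=1..c. fact (s i)) * (\<Prod>i=1..c. (real (l i) / real n) ^ s i)"
    using s(1) by (simp add: multinomial_mass_def multinomial_coeff_def)
  have lnB: "ln (multinomial_mass c n k l s)
    = ln (fact k) - (\<Sum>i=1..c. ln (fact (s i))) + (\<Sum>i=1..c. real (s i) * (ln (real (l i)) - ln (real n)))"
  proof -
    have "ln (\<Prod>i=1..c. fact (s i) :: real) = (\<Sum>i=1..c. ln (fact (s i)))"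
      by (intro ln_prod) auto
    moreover have "ln (\<Prod>i=1..c. (real (l i) / real n) ^ s i) = (\<Sum>i=1..c. ln ((real (l i) / real n) ^ s i))"
      using pos \<open>0 < n\<close> by (intro ln_prod) (auto simp: Suc_le_eq)
    moreover have "\<dots> = (\<Sum>i=1..c. real (s i) * (ln (real (l i)) - ln (real n)))"
      using pos \<open>0 < n\<close> by (intro sum.cong refl) (auto simp: ln_realpow ln_div Suc_le_eq)
    ultimately show ?thesis
      using Bpos1 Bpos2 by (simp only: B ln_mult_pos ln_divide_pos divide_pos_pos fact_gt_zero)
  qed
  have "0 < hypergeom_mass c n k l s" "0 < multinomial_mass c n k l s"
    using Hpos Bpos1 Bpos2 \<open>k \<le> n\<close> by (simp_all add: H B)
  then show ?thesis
    using sum_s by (simp add: ln_div lnH lnB sum.distrib sum_subtractf right_diff_distrib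
        flip: sum_distrib_right)
qed

text \<open>Averaging the logarithm of the ratio replaces \<open>s i\<close> by its mean
  \<open>k l i / n\<close>; only the expectations of \<open>ln (fact (l i - s i))\<close> stay
  implicit and await a lower bound.\<close>

lemma rel_entropy_eq:
  assumes "1 \<le> c" and pos: "\<And>i. i \<in> {1..c} \<Longrightarrow> 1 \<le> l i"
    and sum_l: "(\<Sum>j=1..c. l j) = n" and "k \<le> n" "2 \<le> n"
  shows "rel_entropy c n k l
    = (\<Sum>i=1..c. ln (fact (l i)) - (\<Sum>s\<in>count_vectors c k. hypergeom_mass c n k l s * ln (fact (l i - s i)))
        - real k * real (l i) / real n * ln (real (l i)))
      - ln (fact n) + ln (fact (n - k)) + real k * ln (real n)"
proof -
  let ?H = "hypergeom_mass c n k l" and ?S = "count_vectors c k"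
  define C where "C = - ln (fact n) + ln (fact (n - k)) + real k * ln (real n)"
  have total: "(\<Sum>s\<in>?S. ?H s) = 1"
    using sum_hypergeom_mass[of 1] assms by simp
  have "rel_entropy c n k l
    = (\<Sum>s\<in>?S. ?H s * ((\<Sum>i=1..c. ln (fact (l i)) - ln (fact (l i - s i)) - real (s i) * ln (real (l i))) + C))"
    unfolding rel_entropy_def
  proof (intro sum.cong refl)
    fix s
    show "?H s * ln (?H s / multinomial_mass c n k l s)
      = ?H s * ((\<Sum>i=1..c. ln (fact (l i)) - ln (fact (l i - s i)) - real (s i) * ln (real (l i))) + C)"
      using ln_hypergeom_multinomial_ratio[of c n k l s] assms by (cases "?H s = 0") (auto simp: C_def)
  qed
  also have "\<dots> = (\<Sum>s\<in>?S. \<Sum>i=1..c. ?H s * (ln (fact (l i)) - ln (fact (l i - s i)) - real (s i) * ln (real (l i)))) + C"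
    by (simp add: distrib_left sum.distrib total sum_distrib_left flip: sum_distrib_right)
  also have "(\<Sum>s\<in>?S. \<Sum>i=1..c. ?H s * (ln (fact (l i)) - ln (fact (l i - s i)) - real (s i) * ln (real (l i))))
    = (\<Sum>i=1..c. \<Sum>s\<in>?S. ?H s * (ln (fact (l i)) - ln (fact (l i - s i)) - real (s i) * ln (real (l i))))"
    by (rule sum.swap)
  also have "\<dots> = (\<Sum>i=1..c. ln (fact (l i)) - (\<Sum>s\<in>?S. ?H s * ln (fact (l i - s i)))
      - real k * real (l i) / real n * ln (real (l i)))"
  proof (intro sum.cong refl)
    fix i assume i: "i \<in> {1..c}"
    have "(\<Sum>s\<in>?S. ?H s * (ln (fact (l i)) - ln (fact (l i - s i)) - real (s i) * ln (real (l i))))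
      = ln (fact (l i)) * (\<Sum>s\<in>?S. ?H s) - (\<Sum>s\<in>?S. ?H s * ln (fact (l i - s i)))
        - (\<Sum>s\<in>?S. ?H s * real (s i)) * ln (real (l i))"
      unfolding sum_distrib_left sum_distrib_right sum_subtractf[symmetric]
      by (intro sum.cong refl) algebra
    then show "(\<Sum>s\<in>?S. ?H s * (ln (fact (l i)) - ln (fact (l i - s i)) - real (s i) * ln (real (l i))))
      = ln (fact (l i)) - (\<Sum>s\<in>?S. ?H s * ln (fact (l i - s i)))
        - real k * real (l i) / real n * ln (real (l i))"
      by (simp add: total hypergeom_mass_mean[OF i sum_l \<open>k \<le> n\<close> \<open>2 \<le> n\<close>])
  qed
  finally show ?thesis
    by (simp add: C_def)
qed

subsection \<open>The entropy bound\<close>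

text \<open>Meant for \<open>x = l i\<close> and \<open>\<theta> = (n - k) / n\<close>, so that
  \<open>x * \<theta>\<close> is the mean number of balls left. The longer Stirling expansion, with
  nonincreasing error, bounds the difference from above, and all terms in \<open>ln x\<close>
  cancel.\<close>

lemma ln_Gamma_plus1_diff_le:
  fixes x \<theta> :: real
  assumes "0 < x" "0 < \<theta>" "\<theta> \<le> 1"
  shows "ln_Gamma (x + 1) - ln_Gamma (x * \<theta> + 1) - (x - x * \<theta>) * ln x
    \<le> - (x * \<theta> + 1 / 2) * ln \<theta> - (x - x * \<theta>) + (1 - 1 / \<theta>) / (12 * x)
      + (1 / \<theta> ^ 3 - 1) / (360 * x ^ 3)"
proof -
  have plus1: "ln_Gamma (t + 1) = ln_Gamma t + ln t" if "t > 0" for t :: real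
  proof -
    have "t \<notin> \<int>\<^sub>\<le>\<^sub>0"
      using that by (auto elim!: nonpos_Ints_cases)
    then show ?thesis
      using that by (simp add: ln_Gamma_real_pos Gamma_plus1 ln_mult_pos)
  qed
  have "0 < x * \<theta>" "x * \<theta> \<le> x"
    using assms by (simp_all add: mult_left_le)
  from ln_Gamma_Stirling_antimono[OF this]
  have "ln_Gamma (x + 1) - ln_Gamma (x * \<theta> + 1) - (x - x * \<theta>) * ln x
    \<le> (x + 1 / 2) * ln x - (x * \<theta> + 1 / 2) * ln (x * \<theta>) - (x - x * \<theta>) * ln x - (x - x * \<theta>)
      + (1 / (12 * x) - 1 / (12 * (x * \<theta>))) + (1 / (360 * (x * \<theta>) ^ 3) - 1 / (360 * x ^ 3))"
    unfolding plus1[OF assms(1)] plus1[OF \<open>0 < x * \<theta>\<close>] by (simp add: algebra_simps)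
  also have "(x + 1 / 2) * ln x - (x * \<theta> + 1 / 2) * ln (x * \<theta>) - (x - x * \<theta>) * ln x
      = - (x * \<theta> + 1 / 2) * ln \<theta>"
    using assms by (simp add: ln_mult algebra_simps)
  also have "1 / (12 * x) - 1 / (12 * (x * \<theta>)) = (1 - 1 / \<theta>) / (12 * x)"
    using assms by (simp add: field_simps)
  also have "1 / (360 * (x * \<theta>) ^ 3) - 1 / (360 * x ^ 3) = (1 / \<theta> ^ 3 - 1) / (360 * x ^ 3)"
    using assms by (simp add: field_simps power_mult_distrib)
  finally show ?thesis by simp
qed

text \<open>The difference of \<open>ln_Gamma\<close> at \<open>n - k\<close> and \<open>n\<close>
  enters with the opposite sign to the colour terms, so the shorter expansion with nondecreasing
  error applies and no cubic term arises.\<close>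

lemma ln_fact_diff_le:
  fixes k n :: nat
  assumes "k < n"
  shows "- ln (fact n) + ln (fact (n - k)) + real k * ln (real n)
    \<le> (real n - real k + 1 / 2) * ln ((real n - real k) / real n) + real k
      + real k / (12 * real n * (real n - real k))"
proof -
  have ln_fact: "ln (fact m) = ln_Gamma (real m) + ln (real m)" if "0 < m" for m
    unfolding fact_reduce[OF that] using that by (simp add: ln_Gamma_real_conv_fact ln_mult)
  define M where "M = real n - real k"
  have M: "0 < M" "M \<le> real n" "real (n - k) = M" "real k = real n - M"
    using assms by (auto simp: M_def)
  have "- ln (fact n) + ln (fact (n - k)) + real k * ln (real n)
    \<le> (M + 1 / 2) * ln M - (real n + 1 / 2) * ln (real n) + (real n - M) * ln (real n) + (real n - M)
      + (1 / (12 * M) - 1 / (12 * real n))"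
    using ln_Gamma_Stirling_mono[OF M(1,2)] assms by (simp add: ln_fact M algebra_simps)
  also have "(M + 1 / 2) * ln M - (real n + 1 / 2) * ln (real n) + (real n - M) * ln (real n)
      = (M + 1 / 2) * ln (M / real n)"
    using M(1) assms by (simp add: ln_div algebra_simps)
  also have "1 / (12 * M) - 1 / (12 * real n) = (real n - M) / (12 * real n * M)"
    using M(1) assms by (simp add: field_simps)
  finally show ?thesis
    by (simp add: M)
qed

theorem theorem1p1:
  fixes n k c :: nat and l :: "nat \<Rightarrow> nat"
  assumes "c \<ge> 2"
    and "1 \<le> k" and "real k \<le> real n / 2"
    and "\<forall>r\<in>{1..c}. l r \<ge> 1"
    and "(\<Sum>r=1..c. l r) = n"
  shows "rel_entropy c n k l
    \<le> (real c - 1) / 2 * (ln (real n / (real n - real k)) - real k / (real n - 1))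
      + real k * (2 * real n + 1) / (12 * real n * (real n - 1) * (real n - real k))
        * (\<Sum>i=1..c. real n / real (l i))
      + 1 / 360 * (1 / (real n - real k) ^ 3 - 1 / real n ^ 3)
        * (\<Sum>i=1..c. real n ^ 3 / real (l i) ^ 3)"
proof -
  have pos: "1 \<le> l i" if "i \<in> {1..c}" for i
    using assms(4) that by blast
  have k: "2 * k \<le> n" "2 \<le> n" "k \<le> n" "k < n"
    using assms(2,3) by linarith+
  define M where "M = real n - real k"
  define \<theta> where "\<theta> = M / real n"
  define p where "p = (\<lambda>i. real (l i) / real n)"
  \<comment> \<open>\<open>A\<close> is the factor of the third central moment that all colours
    share. Its sign comes from \<open>2 * k \<le> n\<close>; for \<open>n = 2\<close> it is 0 by
    division by zero.\<close>
  define A where "A = real k * M * (real n - 2 * real k) / ((real n - 1) * (real n - 2))"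
  define q where "q = (\<lambda>i. - Polygamma 2 (real (l i) * \<theta> + 1))"
  define E where "E = (\<lambda>i. \<Sum>s\<in>count_vectors c k. hypergeom_mass c n k l s * ln (fact (l i - s i)))"
  have M: "0 < M" "M \<le> real n"
    using k by (auto simp: M_def)
  have \<theta>: "0 < \<theta>" "\<theta> \<le> 1"
    using M k by (auto simp: \<theta>_def)
  have "0 \<le> A"
    using k M by (auto simp: A_def intro!: divide_nonneg_nonneg mult_nonneg_nonneg)
  have sum_p: "(\<Sum>i=1..c. p i) = 1"
    unfolding p_def using assms(5) k by (simp flip: sum_divide_distrib of_nat_sum)
  have skew: "0 \<le> (\<Sum>i=1..c. q i * (p i * (1 - p i) * (1 - 2 * p i)))"
  proof (rule sum_skewness_nonneg)
    fix i
    show "0 \<le> p i" by (simp add: p_def)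
    have "0 < real (l i) * \<theta> + 1" using \<theta> by (simp add: add_nonneg_pos)
    then have "real (l i) * \<theta> + 1 \<notin> \<int>\<^sub>\<le>\<^sub>0" by (auto elim!: nonpos_Ints_cases)
    then show "0 \<le> q i"
      unfolding q_def using Polygamma_real_even_neg[of "real (l i) * \<theta> + 1" 2]
        \<open>0 < real (l i) * \<theta> + 1\<close> by simp
    fix j assume "p i \<le> p j"
    then have "real (l i) * \<theta> \<le> real (l j) * \<theta>"
      using k \<theta> by (simp add: p_def divide_le_cancel)
    then show "q j \<le> q i"
      unfolding q_def using \<open>0 < real (l i) * \<theta> + 1\<close> by (auto intro!: Polygamma_real_mono)
  qed (use sum_p in simp_all)
  have colour: "ln (fact (l i)) - E i - real k * real (l i) / real n * ln (real (l i))
    \<le> - (p i * M + 1 / 2) * ln \<theta> - real k * p i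
      - real k / (2 * (real n - 1)) * (1 - p i)
      + (real k * (2 * real n + 1) / (12 * real n * (real n - 1) * M) * (real n / real (l i))
        - real k / (4 * (real n - 1) * M))
      + 1 / 360 * (1 / M ^ 3 - 1 / real n ^ 3) * (real n ^ 3 / real (l i) ^ 3)
      - A / 6 * (q i * (p i * (1 - p i) * (1 - 2 * p i)))"
    if i: "i \<in> {1..c}" for i
  proof -
    define x where "x = real (l i)"
    define V where "V = real k * p i * (1 - p i) * M / (real n - 1)"
    have x: "0 < x" using pos[OF i] by (simp add: x_def)
    have px: "p i = x / real n" and qx: "q i = - Polygamma 2 (x * \<theta> + 1)"
      by (simp_all add: p_def q_def x_def)
    have mu: "x * M / real n = x * \<theta>" by (simp add: \<theta>_def)
    have "l i \<le> n"
      using i assms(5) member_le_sum[of i "{1..c}" l] by simp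
    then have "0 \<le> V"
      using k M by (auto simp: V_def p_def intro!: divide_nonneg_nonneg mult_nonneg_nonneg)
    have "ln_Gamma (x * \<theta> + 1) + Polygamma 1 (x * \<theta> + 1) / 2 * V
        - Polygamma 2 (x * \<theta> + 1) / 6 * (p i * (1 - p i) * (1 - 2 * p i) * A) \<le> E i"
      using expectation_ln_fact_ge[OF i assms(5) k(3,2,1)]
      unfolding E_def V_def A_def p_def M_def[symmetric] x_def[symmetric] mu .
    moreover have "(1 / (x * \<theta>) - 1 / (2 * (x * \<theta>) ^ 2)) / 2 * V \<le> Polygamma 1 (x * \<theta> + 1) / 2 * V"
      using Polygamma_1_plus1_ge[of "x * \<theta>"] x \<theta> \<open>0 \<le> V\<close> by (intro mult_right_mono) auto
    \<comment> \<open>Since \<open>x * \<theta> = p i * M\<close>, the first part gives the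
      \<open>k / (n - 1)\<close> correction of the leading term, and the second part is of the order
      of the Stirling term.\<close>
    moreover have "(1 / (x * \<theta>) - 1 / (2 * (x * \<theta>) ^ 2)) / 2 * V
      = real k / (2 * (real n - 1)) * (1 - p i) - real k / (4 * (real n - 1)) * (real n / (x * M) - 1 / M)"
      using x M k by (simp add: V_def px \<theta>_def divide_simps) algebra
    moreover have "ln (fact (l i)) = ln_Gamma (x + 1)"
      using ln_Gamma_real_conv_fact[of "Suc (l i)"] by (simp add: x_def add.commute)
    moreover have "x - x * \<theta> = real k * p i"
      using k by (simp add: \<theta>_def M_def px field_simps)
    moreover have "x * \<theta> = p i * M"
      by (simp add: \<theta>_def px)
    moreover have "(1 - 1 / \<theta>) / (12 * x) = - (real k / (12 * real n * M) * (real n / x))"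
      using x M k by (simp add: \<theta>_def M_def field_simps)
    moreover have "(1 / \<theta> ^ 3 - 1) / (360 * x ^ 3)
      = 1 / 360 * (1 / M ^ 3 - 1 / real n ^ 3) * (real n ^ 3 / x ^ 3)"
      using x M k by (simp add: \<theta>_def field_simps)
    \<comment> \<open>The trigamma correction and the Stirling term combine through
      \<open>3n - (n - 1) = 2n + 1\<close>. Each colour also leaves over
      \<open>- k / (4 (n - 1) M)\<close>.\<close>
    moreover have "real k / (4 * (real n - 1)) * (real n / (x * M) - 1 / M)
        - real k / (12 * real n * M) * (real n / x)
      = real k * (2 * real n + 1) / (12 * real n * (real n - 1) * M) * (real n / x)
        - real k / (4 * (real n - 1) * M)"
      using x M k by (simp add: divide_simps) algebra
    moreover have "Polygamma 2 (x * \<theta> + 1) / 6 * (p i * (1 - p i) * (1 - 2 * p i) * A)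
      = - (A / 6 * (q i * (p i * (1 - p i) * (1 - 2 * p i))))"
      by (simp add: qx)
    moreover have "real k * real (l i) / real n = real k * p i"
      by (simp add: p_def)
    ultimately show ?thesis
      using ln_Gamma_plus1_diff_le[OF x \<theta>] by (simp only: x_def[symmetric])
  qed
  have rest: "- ln (fact n) + ln (fact (n - k)) + real k * ln (real n)
    \<le> (M + 1 / 2) * ln \<theta> + real k + real k / (12 * real n * M)"
    using ln_fact_diff_le[OF k(4)] by (simp add: M_def \<theta>_def)
  \<comment> \<open>The leftovers of the \<open>c\<close> colours absorb the Stirling remainder of
    \<open>ln (fact n)\<close>.\<close>
  have "real k / (12 * real n * M) \<le> real c * (real k / (4 * (real n - 1) * M))"
  proof -
    have "real k / (12 * real n * M) \<le> real k / (4 * (real n - 1) * M)"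
      using M k by (intro divide_left_mono mult_right_mono mult_pos_pos) auto
    also have "\<dots> \<le> real c * (real k / (4 * (real n - 1) * M))"
      using M k assms(1) mult_right_mono[of 1 "real c" "real k / (4 * (real n - 1) * M)"] by simp
    finally show ?thesis .
  qed
  moreover have "rel_entropy c n k l
    \<le> (\<Sum>i=1..c. - (p i * M + 1 / 2) * ln \<theta> - real k * p i
      - real k / (2 * (real n - 1)) * (1 - p i)
      + (real k * (2 * real n + 1) / (12 * real n * (real n - 1) * M) * (real n / real (l i))
        - real k / (4 * (real n - 1) * M))
      + 1 / 360 * (1 / M ^ 3 - 1 / real n ^ 3) * (real n ^ 3 / real (l i) ^ 3)
      - A / 6 * (q i * (p i * (1 - p i) * (1 - 2 * p i))))
      + ((M + 1 / 2) * ln \<theta> + real k + real k / (12 * real n * M))"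
  proof -
    have "rel_entropy c n k l = (\<Sum>i=1..c. ln (fact (l i)) - E i
        - real k * real (l i) / real n * ln (real (l i)))
      + (- ln (fact n) + ln (fact (n - k)) + real k * ln (real n))"
      using rel_entropy_eq[of c l n k] assms(1,5) k pos by (simp add: E_def)
    then show ?thesis
      by (elim ssubst) (intro add_mono sum_mono colour rest)
  qed
  moreover have "(\<Sum>i=1..c. - (p i * M + 1 / 2) * ln \<theta> - real k * p i
      - real k / (2 * (real n - 1)) * (1 - p i)
      + (real k * (2 * real n + 1) / (12 * real n * (real n - 1) * M) * (real n / real (l i))
        - real k / (4 * (real n - 1) * M))
      + 1 / 360 * (1 / M ^ 3 - 1 / real n ^ 3) * (real n ^ 3 / real (l i) ^ 3)
      - A / 6 * (q i * (p i * (1 - p i) * (1 - 2 * p i))))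
    = - (M + real c / 2) * ln \<theta> - real k - real k / (2 * (real n - 1)) * (real c - 1)
      + real k * (2 * real n + 1) / (12 * real n * (real n - 1) * M) * (\<Sum>i=1..c. real n / real (l i))
      - real c * (real k / (4 * (real n - 1) * M))
      + 1 / 360 * (1 / M ^ 3 - 1 / real n ^ 3) * (\<Sum>i=1..c. real n ^ 3 / real (l i) ^ 3)
      - A / 6 * (\<Sum>i=1..c. q i * (p i * (1 - p i) * (1 - 2 * p i)))"
    by (simp only: sum.distrib sum_subtractf sum_negf sum_p sum_constant card_atLeastAtMost
        flip: sum_distrib_left sum_distrib_right) simp
  moreover have "0 \<le> A / 6 * (\<Sum>i=1..c. q i * (p i * (1 - p i) * (1 - 2 * p i)))"
    using skew \<open>0 \<le> A\<close> by simp
  \<comment> \<open>The terms \<open>M * ln \<theta>\<close> cancel between the urn and the colours;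
    the halves leave \<open>(1 - c) / 2\<close> times \<open>ln \<theta>\<close>.\<close>
  moreover have "(M + 1 / 2) * ln \<theta> - (M + real c / 2) * ln \<theta> = (real c - 1) / 2 * ln (real n / M)"
    using M k by (simp add: \<theta>_def ln_div field_simps)
  moreover have "real k / (2 * (real n - 1)) * (real c - 1) = (real c - 1) / 2 * (real k / (real n - 1))"
    by simp
  ultimately show ?thesis
    unfolding M_def[symmetric] right_diff_distrib by linarith
qed

end
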